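(* For every integer $n\ge1$ and $r\in[0,1)$, $$\Big[\frac{1+r}{2}\Big(1-\frac1n\Big)\Big]^{1/2}\sqrt{\frac{n}{1-r}}\le\mathcal{I}_{n,r}\big(H^2,B^{1/2}_{2,2}\big).$$ Consequently, for every $r\in[0,1)$, $$\sqrt{\frac{(1+r)/2}{1-r}}\le\liminf_{n\to\infty}\frac{\mathcal{I}_{n,r}(H^2,B^{1/2}_{2,2})}{\sqrt n}\le\limsup_{n\to\infty}\frac{\mathcal{I}_{n,r}(H^2,B^{1/2}_{2,2})}{\sqrt n}\le\sqrt{\frac{1+r}{1-r}},$$ and $$\frac{\sqrt2}{2}\le\liminf_{r\to1^-}\liminf_{n\to\infty}\sqrt{\frac{1-r}{n}}\,\mathcal{I}_{n,r}\big(H^2,B^{1/2}_{2,2}\big)\le\limsup_{r\to1^-}\limsup_{n\to\infty}\sqrt{\frac{1-r}{n}}\,\mathcal{I}_{n,r}\big(H^2,B^{1/2}_{2,2}\big)\le\sqrt2 .$$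
   Context: $\mathbb{D}$ is the open unit disc, $\hat f(k)$ the $k$-th Taylor coefficient. $\|f\|_{H^2}^2=\sum_{k\ge0}|\hat f(k)|^2$; the Dirichlet space $B^{1/2}_{2,2}=\{f:\|f\|^2_{B^{1/2}_{2,2}}=\sum_{k\ge0}(k+1)|\hat f(k)|^2<\infty\}$. For $\lambda\in\mathbb{D}$, $b_\lambda(z)=\frac{\lambda-z}{1-\bar\lambda z}$; for a finite sequence $\sigma=(\lambda_1,\dots,\lambda_n)$ in $\mathbb{D}$ (repetitions allowed), $B_\sigma=\prod_j b_{\lambda_j}$, and "$g_{|\sigma}=f_{|\sigma}$" means $f-g\in B_\sigma\mathrm{Hol}(\mathbb{D})$. $I(\sigma,X,Y)=\sup_{f\in X,\|f\|_X\le1}\inf\{\|g\|_Y: g\in Y,\ g_{|\sigma}=f_{|\sigma}\}$, and $\mathcal{I}_{n,r}(X,Y)=\sup\{I(\sigma,X,Y):\sigma$ has at most $n$ points counted with multiplicity, all with $|\lambda|\le r\}$. *)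

theory Defs
  imports "HOL-Analysis.Analysis"
begin

definition taylor_coef :: "(complex \<Rightarrow> complex) \<Rightarrow> nat \<Rightarrow> complex" where
  "taylor_coef f k = (deriv ^^ k) f 0 / of_nat (fact k)"

definition in_H2 :: "(complex \<Rightarrow> complex) \<Rightarrow> bool" where
  "in_H2 f \<longleftrightarrow> f holomorphic_on ball 0 1 \<and> summable (\<lambda>k. (cmod (taylor_coef f k))^2)"

definition H2_norm :: "(complex \<Rightarrow> complex) \<Rightarrow> real" where
  "H2_norm f = sqrt (\<Sum>k. (cmod (taylor_coef f k))^2)"

definition in_Dir :: "(complex \<Rightarrow> complex) \<Rightarrow> bool" where
  "in_Dir f \<longleftrightarrow> f holomorphic_on ball 0 1 \<and>
     summable (\<lambda>k. real (k + 1) * (cmod (taylor_coef f k))^2)"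

definition Dir_norm :: "(complex \<Rightarrow> complex) \<Rightarrow> real" where
  "Dir_norm f = sqrt (\<Sum>k. real (k + 1) * (cmod (taylor_coef f k))^2)"

definition blaschke_factor :: "complex \<Rightarrow> complex \<Rightarrow> complex" where
  "blaschke_factor l z = (l - z) / (1 - cnj l * z)"

definition blaschke_prod :: "complex list \<Rightarrow> complex \<Rightarrow> complex" where
  "blaschke_prod \<sigma> z = prod_list (map (\<lambda>l. blaschke_factor l z) \<sigma>)"

definition agree_on_seq :: "complex list \<Rightarrow> (complex \<Rightarrow> complex) \<Rightarrow> (complex \<Rightarrow> complex) \<Rightarrow> bool" where
  "agree_on_seq \<sigma> g f \<longleftrightarrow>
     (\<exists>h. h holomorphic_on ball 0 1 \<and> (\<forall>z\<in>ball 0 1. f z - g z = blaschke_prod \<sigma> z * h z))"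

definition interp_const ::
  "complex list \<Rightarrow> ((complex \<Rightarrow> complex) \<Rightarrow> bool) \<Rightarrow> ((complex \<Rightarrow> complex) \<Rightarrow> real)
     \<Rightarrow> ((complex \<Rightarrow> complex) \<Rightarrow> bool) \<Rightarrow> ((complex \<Rightarrow> complex) \<Rightarrow> real) \<Rightarrow> ereal" where
  "interp_const \<sigma> X nX Y nY =
     (SUP f\<in>{f. X f \<and> nX f \<le> 1}. INF g\<in>{g. Y g \<and> agree_on_seq \<sigma> g f}. ereal (nY g))"

definition interp_nr ::
  "nat \<Rightarrow> real \<Rightarrow> ((complex \<Rightarrow> complex) \<Rightarrow> bool) \<Rightarrow> ((complex \<Rightarrow> complex) \<Rightarrow> real)
     \<Rightarrow> ((complex \<Rightarrow> complex) \<Rightarrow> bool) \<Rightarrow> ((complex \<Rightarrow> complex) \<Rightarrow> real) \<Rightarrow> ereal" where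
  "interp_nr n r X nX Y nY =
     (SUP \<sigma>\<in>{\<sigma>. length \<sigma> \<le> n \<and> (\<forall>l\<in>set \<sigma>. cmod l \<le> r)}. interp_const \<sigma> X nX Y nY)"

abbreviation I_H2_Dir :: "nat \<Rightarrow> real \<Rightarrow> ereal" where
  "I_H2_Dir n r \<equiv> interp_nr n r in_H2 H2_norm in_Dir Dir_norm"

end

theory Submission
  imports Defs "HOL-Complex_Analysis.Cauchy_Integral_Formula"
begin

text \<open>
  Write a Taylor series \<open>A\<close> as \<open>c k + b X\<close> with \<open>k\<close> the Szego kernel at a point \<open>l\<close> and \<open>b\<close> the
  Blaschke factor. On coefficients this is a unitary linear system with input \<open>x\<close>, output \<open>a\<close> and a
  state \<open>d\<close> with \<open>d 0 = c\<close>: with \<open>s = 1 - \<bar>l\<bar>\<^sup>2\<close>,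
  \<open>\<bar>a k\<bar>\<^sup>2 = \<bar>x k\<bar>\<^sup>2 + (\<bar>d k\<bar>\<^sup>2 - \<bar>d (k + 1)\<bar>\<^sup>2) / s\<close>.
  Summing gives \<open>\<parallel>a\<parallel>\<^sup>2 = \<parallel>x\<parallel>\<^sup>2 + \<bar>c\<bar>\<^sup>2 / s\<close>, and summing with the weights \<open>k + 1\<close> shows that the squared
  Dirichlet norm of \<open>a\<close> exceeds that of \<open>x\<close> by \<open>\<parallel>d\<parallel>\<^sup>2 / s\<close>.

  For the upper bound, decompose \<open>f\<close> successively along \<open>\<sigma>\<close> and replace the last quotient by \<open>0\<close>.
  Since \<open>\<parallel>d\<parallel>\<^sup>2 \<le> (\<bar>c\<bar>\<^sup>2 + s\<^sup>2 \<parallel>x\<parallel>\<^sup>2) / (1 - \<bar>l\<bar>)\<^sup>2\<close>, every point contributes at most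
  \<open>(1 + r) / (1 - r)\<close>, up to errors whose sum is bounded independently of \<open>n\<close>.

  For the lower bound take \<open>n\<close> times the point \<open>r\<close> and let \<open>f\<close> have the coefficients \<open>(-1)\<^sup>i / sqrt n\<close> in
  the Malmquist basis. Every interpolant of \<open>f\<close> shares its first \<open>n\<close> coefficients \<open>c i\<close>, and
  the states satisfy \<open>d = a - r x\<close>, so that their norms are bounded below by sums of the
  \<open>\<bar>c i - r * c (i + 1)\<bar>\<^sup>2\<close>.
\<close>

subsection \<open>Square summable coefficient sequences\<close>

definition sq_summable :: "(nat \<Rightarrow> complex) \<Rightarrow> bool" where
  "sq_summable a \<longleftrightarrow> summable (\<lambda>k. (cmod (a k))\<^sup>2)"

definition sq_sum :: "(nat \<Rightarrow> complex) \<Rightarrow> real" where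
  "sq_sum a = (\<Sum>k. (cmod (a k))\<^sup>2)"

abbreviation power_series :: "(nat \<Rightarrow> complex) \<Rightarrow> complex \<Rightarrow> complex" where
  "power_series a \<equiv> eval_fps (Abs_fps a)"

lemma sq_sum_nonneg: "sq_summable a \<Longrightarrow> sq_sum a \<ge> 0"
  unfolding sq_sum_def sq_summable_def by (rule suminf_nonneg) auto

lemma sq_summable_add:
  assumes "sq_summable a" "sq_summable b"
  shows "sq_summable (\<lambda>k. a k + b k)"
  unfolding sq_summable_def
proof (rule summable_comparison_test')
  show "summable (\<lambda>k. 2 * (cmod (a k))\<^sup>2 + 2 * (cmod (b k))\<^sup>2)"
    using assms unfolding sq_summable_def by (intro summable_add summable_mult)
  fix k
  have "(cmod (a k + b k))\<^sup>2 \<le> (cmod (a k) + cmod (b k))\<^sup>2"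
    by (intro power_mono norm_triangle_ineq) auto
  also have "\<dots> \<le> 2 * (cmod (a k))\<^sup>2 + 2 * (cmod (b k))\<^sup>2"
    using sum_squares_bound[of "cmod (a k)" "cmod (b k)"] by (simp add: power2_sum)
  finally show "norm ((cmod (a k + b k))\<^sup>2) \<le> 2 * (cmod (a k))\<^sup>2 + 2 * (cmod (b k))\<^sup>2"
    by simp
qed

lemma sq_summable_cmult:
  assumes "sq_summable a"
  shows "sq_summable (\<lambda>k. c * a k)"
  using assms unfolding sq_summable_def by (simp add: norm_mult power_mult_distrib summable_mult)

lemma sq_summable_shift: "sq_summable a \<Longrightarrow> sq_summable (\<lambda>k. a (k + m))"
  unfolding sq_summable_def by (rule summable_ignore_initial_segment)

text \<open>Comparison with a geometric series through
  \<open>2 * u * v \<le> u\<^sup>2 + v\<^sup>2\<close>.\<close>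

lemma sq_summable_power_series:
  assumes "sq_summable a" "cmod z < 1"
  shows "summable (\<lambda>k. cmod (a k * z ^ k))" "summable (\<lambda>k. a k * z ^ k)"
proof -
  show "summable (\<lambda>k. cmod (a k * z ^ k))"
  proof (rule summable_comparison_test')
    have "(cmod z)\<^sup>2 < 1"
      using assms(2) by (simp add: power_less_one_iff)
    then show "summable (\<lambda>k. (cmod (a k))\<^sup>2 + ((cmod z)\<^sup>2) ^ k)"
      using assms(1) unfolding sq_summable_def by (intro summable_add summable_geometric) auto
    fix k
    have "2 * cmod (a k) * cmod z ^ k \<le> (cmod (a k))\<^sup>2 + (cmod z ^ k)\<^sup>2"
      by (rule sum_squares_bound)
    moreover have "0 \<le> cmod (a k) * cmod z ^ k"
      by simp
    moreover have "(cmod z ^ k)\<^sup>2 = ((cmod z)\<^sup>2) ^ k"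
      by (simp add: power_mult [symmetric] mult.commute)
    ultimately have "cmod (a k) * cmod z ^ k \<le> (cmod (a k))\<^sup>2 + ((cmod z)\<^sup>2) ^ k"
      by linarith
    then show "norm (cmod (a k * z ^ k)) \<le> (cmod (a k))\<^sup>2 + ((cmod z)\<^sup>2) ^ k"
      by (simp add: norm_mult norm_power)
  qed
  then show "summable (\<lambda>k. a k * z ^ k)"
    by (rule summable_norm_cancel)
qed

lemma sq_summable_power_series_sums:
  assumes "sq_summable a" "cmod z < 1"
  shows "(\<lambda>k. a k * z ^ k) sums power_series a z"
  using sq_summable_power_series(2)[OF assms] by (simp add: eval_fps_def summable_sums)

lemma sq_summable_conv_radius:
  assumes "sq_summable a"
  shows "fps_conv_radius (Abs_fps a) \<ge> 1"
  unfolding fps_conv_radius_def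
proof (rule conv_radius_geI_ex')
  fix r :: real assume "0 < r" "ereal r < 1"
  then have "cmod (of_real r) < 1"
    by simp
  then show "summable (\<lambda>n. fps_nth (Abs_fps a) n * of_real r ^ n)"
    using sq_summable_power_series(2)[OF assms] by simp
qed

lemma holomorphic_power_series_unit_disc:
  assumes "sq_summable a"
  shows "power_series a holomorphic_on ball 0 1"
proof (rule holomorphic_on_eval_fps)
  show "ball (0::complex) 1 \<subseteq> eball 0 (fps_conv_radius (Abs_fps a))"
  proof
    fix z :: complex assume "z \<in> ball 0 1"
    then have "ereal (cmod z) < 1" by simp
    also note sq_summable_conv_radius[OF assms]
    finally show "z \<in> eball 0 (fps_conv_radius (Abs_fps a))"
      by (simp add: in_eball_iff)
  qed
qed

lemma taylor_coef_power_series: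
  assumes "sq_summable a"
  shows "taylor_coef (power_series a) = a"
proof
  fix n
  have "(0::ereal) < 1"
    by simp
  also note sq_summable_conv_radius[OF assms]
  finally have "power_series a has_fps_expansion Abs_fps a"
    by (rule eval_fps_has_fps_expansion)
  from fps_nth_fps_expansion[OF this, of n] show "taylor_coef (power_series a) n = a n"
    by (simp add: taylor_coef_def)
qed

lemma power_series_taylor_coef:
  assumes "f holomorphic_on ball 0 1" "cmod z < 1"
  shows "power_series (taylor_coef f) z = f z"
  using holomorphic_power_series[OF assms(1), of z] assms(2)
  by (simp add: eval_fps_def taylor_coef_def sums_iff)

subsection \<open>Adding one Blaschke factor\<close>

text \<open>The relations of the next locale say that the generating functions satisfy
  \<open>(1 - cnj l * z) * A z = d 0 + (l - z) * X z\<close>, that is, \<open>A\<close> is a multiple of the Szego kernel at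
  \<open>l\<close> plus \<open>blaschke_factor l\<close> times \<open>X\<close>; the sequence \<open>d\<close> is the state of this unitary system.\<close>

locale blaschke_step =
  fixes l :: complex and a d x :: "nat \<Rightarrow> complex"
  assumes norm_less_1: "cmod l < 1"
    and out_eq: "\<And>k. a k = d k + l * x k"
    and state_eq: "\<And>k. d (Suc k) = cnj l * d k - of_real (1 - (cmod l)\<^sup>2) * x k"
begin

lemma defect_pos: "0 < 1 - (cmod l)\<^sup>2"
  using norm_less_1 by (simp add: power_less_one_iff)

lemma shift: "blaschke_step l (\<lambda>k. a (k + m)) (\<lambda>k. d (k + m)) (\<lambda>k. x (k + m))"
  using norm_less_1 out_eq state_eq by unfold_locales auto

text \<open>With \<open>s = 1 - (cmod l)\<^sup>2\<close>, one step sends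
  \<open>(d k / sqrt s, x k)\<close> to \<open>(d (Suc k) / sqrt s, a k)\<close> by the unitary
  matrix with rows \<open>(cnj l, - sqrt s)\<close> and \<open>(sqrt s, l)\<close>.\<close>

lemma energy:
  "(cmod (a k))\<^sup>2 = (cmod (x k))\<^sup>2 + ((cmod (d k))\<^sup>2 - (cmod (d (Suc k)))\<^sup>2) / (1 - (cmod l)\<^sup>2)"
proof -
  have "(1 - (cmod l)\<^sup>2) * ((cmod (a k))\<^sup>2 - (cmod (x k))\<^sup>2) = (cmod (d k))\<^sup>2 - (cmod (d (Suc k)))\<^sup>2"
    unfolding out_eq state_eq by (simp add: cmod_power2) (simp add: power2_eq_square algebra_simps)
  then show ?thesis
    using defect_pos by (simp add: field_simps)
qed

lemma energy_sum:
  "(\<Sum>k<K. (cmod (a k))\<^sup>2) = (\<Sum>k<K. (cmod (x k))\<^sup>2)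
     + ((cmod (d 0))\<^sup>2 - (cmod (d K))\<^sup>2) / (1 - (cmod l)\<^sup>2)"
  by (induction K) (simp_all add: energy diff_divide_distrib)

text \<open>Summation by parts: the weights turn the telescoping differences of
  \<open>energy\<close> into a sum over all states, which is how the norm of \<open>d\<close> enters
  the Dirichlet norm.\<close>

lemma weighted_energy_sum:
  "(\<Sum>k<K. real (k + 1) * (cmod (a k))\<^sup>2) = (\<Sum>k<K. real (k + 1) * (cmod (x k))\<^sup>2)
     + ((\<Sum>k<K. (cmod (d k))\<^sup>2) - real K * (cmod (d K))\<^sup>2) / (1 - (cmod l)\<^sup>2)"
proof (induction K)
  case (Suc K)
  have "real (K + 1) * (cmod (a K))\<^sup>2 = real (K + 1) * (cmod (x K))\<^sup>2
      + (real (K + 1) * (cmod (d K))\<^sup>2 - real (K + 1) * (cmod (d (Suc K)))\<^sup>2) / (1 - (cmod l)\<^sup>2)"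
    unfolding energy[of K] by (simp only: distrib_left right_diff_distrib times_divide_eq_right)
  with Suc show ?case
    by (simp add: diff_divide_distrib add_divide_distrib distrib_right)
qed simp

text \<open>The recursion says that \<open>d\<close> is a source plus \<open>cnj l\<close> times
  \<open>d\<close> delayed by one step, so the norm of \<open>d\<close> times
  \<open>1 - cmod l\<close> is at most the norm of the source. The source has the entries
  \<open>d 0\<close> and then minus \<open>1 - (cmod l)\<^sup>2\<close> times those of
  \<open>x\<close>; its moduli are \<open>y\<close>, those of the delayed state are
  \<open>p\<close>. Truncation at \<open>K\<close> keeps all norms finite, so that the norm of
  \<open>d\<close> can be moved to the left before its summability is known.\<close>

lemma state_partial_bound:
  assumes x: "sq_summable x"
  shows "(\<Sum>k<K. (cmod (d k))\<^sup>2)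
    \<le> ((cmod (d 0))\<^sup>2 + (1 - (cmod l)\<^sup>2)\<^sup>2 * sq_sum x) / (1 - cmod l)\<^sup>2"
proof (cases K)
  case 0
  then show ?thesis
    using sq_sum_nonneg[OF x] by simp
next
  case (Suc N)
  define y where "y k = (case k of 0 \<Rightarrow> cmod (d 0) | Suc j \<Rightarrow> (1 - (cmod l)\<^sup>2) * cmod (x j))" for k
  define p where "p k = (case k of 0 \<Rightarrow> 0 | Suc j \<Rightarrow> cmod (d j))" for k
  let ?D = "L2_set (\<lambda>k. cmod (d k)) {..<K}"
  have "cmod (d k) \<le> y k + cmod l * p k" for k
  proof (cases k)
    case (Suc j)
    have "cmod (d (Suc j)) \<le> cmod (cnj l * d j) + cmod (of_real (1 - (cmod l)\<^sup>2) * x j)"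
      unfolding state_eq by (rule norm_triangle_ineq4)
    also have "\<dots> = cmod l * cmod (d j) + (1 - (cmod l)\<^sup>2) * cmod (x j)"
      using defect_pos by (simp only: norm_mult complex_mod_cnj norm_of_real)
    finally show ?thesis
      using Suc by (simp add: y_def p_def)
  qed (simp add: y_def p_def)
  then have "?D \<le> L2_set (\<lambda>k. y k + cmod l * p k) {..<K}"
    by (intro L2_set_mono) auto
  also have "\<dots> \<le> L2_set y {..<K} + L2_set (\<lambda>k. cmod l * p k) {..<K}"
    by (rule L2_set_triangle_ineq)
  also have "L2_set (\<lambda>k. cmod l * p k) {..<K} = cmod l * L2_set p {..<K}"
    by (simp add: L2_set_right_distrib)
  finally have D_le: "?D \<le> L2_set y {..<K} + cmod l * L2_set p {..<K}" .
  have "L2_set p {..<K} \<le> ?D"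
  proof -
    have "(\<Sum>k<K. (p k)\<^sup>2) = (\<Sum>k<N. (cmod (d k))\<^sup>2)"
      by (simp add: p_def Suc sum.lessThan_Suc_shift del: sum.lessThan_Suc)
    also have "\<dots> \<le> (\<Sum>k<K. (cmod (d k))\<^sup>2)"
      by (simp add: Suc)
    finally show ?thesis
      unfolding L2_set_def by (rule real_sqrt_le_mono)
  qed
  then have "cmod l * L2_set p {..<K} \<le> cmod l * ?D"
    by (simp add: mult_left_mono)
  with D_le have "?D * (1 - cmod l) \<le> L2_set y {..<K}"
    by (simp add: algebra_simps)
  then have "(?D * (1 - cmod l))\<^sup>2 \<le> (L2_set y {..<K})\<^sup>2"
    using norm_less_1 by (intro power_mono mult_nonneg_nonneg L2_set_nonneg) auto
  also have "\<dots> = (\<Sum>k<K. (y k)\<^sup>2)"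
    by (simp add: L2_set_def sum_nonneg)
  also have "\<dots> = (cmod (d 0))\<^sup>2 + (1 - (cmod l)\<^sup>2)\<^sup>2 * (\<Sum>k<N. (cmod (x k))\<^sup>2)"
    by (simp add: Suc sum.lessThan_Suc_shift y_def power_mult_distrib sum_distrib_left
      del: sum.lessThan_Suc)
  also have "\<dots> \<le> (cmod (d 0))\<^sup>2 + (1 - (cmod l)\<^sup>2)\<^sup>2 * sq_sum x"
    using x unfolding sq_summable_def sq_sum_def
    by (intro add_left_mono mult_left_mono sum_le_suminf) auto
  finally have "(\<Sum>k<K. (cmod (d k))\<^sup>2) * (1 - cmod l)\<^sup>2
      \<le> (cmod (d 0))\<^sup>2 + (1 - (cmod l)\<^sup>2)\<^sup>2 * sq_sum x"
    by (simp add: L2_set_def sum_nonneg power_mult_distrib)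
  then show ?thesis
    using norm_less_1 by (simp add: pos_le_divide_eq)
qed

lemma sq_summable_state: "sq_summable x \<Longrightarrow> sq_summable d"
  unfolding sq_summable_def[of d]
  by (rule summableI_nonneg_bounded[OF _ state_partial_bound]) auto

lemma sq_summable_out: "sq_summable x \<Longrightarrow> sq_summable a"
  using sq_summable_add[OF sq_summable_state sq_summable_cmult[of x l]]
  by (simp flip: out_eq)

lemma state_tendsto_0:
  assumes "sq_summable x"
  shows "(\<lambda>k. (cmod (d k))\<^sup>2) \<longlonglongrightarrow> 0"
  using sq_summable_state[OF assms] unfolding sq_summable_def by (rule summable_LIMSEQ_zero)

lemma sq_sum_out:
  assumes x: "sq_summable x"
  shows "sq_sum a = sq_sum x + (cmod (d 0))\<^sup>2 / (1 - (cmod l)\<^sup>2)"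
proof -
  have "(\<lambda>K. (\<Sum>k<K. (cmod (x k))\<^sup>2) + ((cmod (d 0))\<^sup>2 - (cmod (d K))\<^sup>2) / (1 - (cmod l)\<^sup>2))
    \<longlonglongrightarrow> sq_sum x + ((cmod (d 0))\<^sup>2 - 0) / (1 - (cmod l)\<^sup>2)"
    using x defect_pos unfolding sq_summable_def sq_sum_def
    by (intro tendsto_intros summable_LIMSEQ state_tendsto_0 x) auto
  moreover have "(\<lambda>K. \<Sum>k<K. (cmod (a k))\<^sup>2) \<longlonglongrightarrow> sq_sum a"
    using sq_summable_out[OF x] unfolding sq_summable_def sq_sum_def by (rule summable_LIMSEQ)
  ultimately show ?thesis
    unfolding energy_sum by (auto dest: LIMSEQ_unique)
qed

lemma power_series_out:
  assumes x: "sq_summable x" and z: "cmod z < 1"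
  shows "(1 - cnj l * z) * power_series a z = d 0 + (l - z) * power_series x z"
proof -
  let ?s = "of_real (1 - (cmod l)\<^sup>2) :: complex"
  note X = sq_summable_power_series_sums[OF x z]
  note D = sq_summable_power_series_sums[OF sq_summable_state[OF x] z]
  have "(\<lambda>k. d k * z ^ k + l * (x k * z ^ k)) sums (power_series d z + l * power_series x z)"
    by (intro sums_add sums_mult X D)
  then have "(\<lambda>k. a k * z ^ k) sums (power_series d z + l * power_series x z)"
    by (simp add: out_eq algebra_simps)
  then have A: "power_series a z = power_series d z + l * power_series x z"
    using sums_unique2 sq_summable_power_series_sums[OF sq_summable_out[OF x] z] by blast
  have "(\<lambda>k. cnj l * z * (d k * z ^ k) - ?s * z * (x k * z ^ k)) sums
      (cnj l * z * power_series d z - ?s * z * power_series x z)"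
    by (intro sums_diff sums_mult X D)
  then have "(\<lambda>k. d (Suc k) * z ^ Suc k) sums
      (cnj l * z * power_series d z - ?s * z * power_series x z)"
    by (simp add: state_eq algebra_simps)
  then have "(\<lambda>k. d k * z ^ k) sums
      (cnj l * z * power_series d z - ?s * z * power_series x z + d 0)"
    by (subst (asm) sums_Suc_iff) simp
  then have "power_series d z = cnj l * z * power_series d z - ?s * z * power_series x z + d 0"
    using sums_unique2 D by blast
  moreover have "?s = 1 - l * cnj l"
    using complex_norm_square[of l] by simp
  ultimately have D': "power_series d z * (1 - cnj l * z)
      = d 0 - (1 - l * cnj l) * z * power_series x z"
    by (simp add: algebra_simps)
  have "(1 - cnj l * z) * power_series a z
      = power_series d z * (1 - cnj l * z) + (1 - cnj l * z) * l * power_series x z"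
    unfolding A by (simp add: algebra_simps)
  also have "\<dots> = d 0 + (l - z) * power_series x z"
    unfolding D' by (simp add: algebra_simps)
  finally show ?thesis .
qed

lemma weighted_sum_bound:
  assumes x: "sq_summable x"
    and wx: "summable (\<lambda>k. real (k + 1) * (cmod (x k))\<^sup>2)"
  defines "C \<equiv> (\<Sum>k. real (k + 1) * (cmod (x k))\<^sup>2)
    + ((cmod (d 0))\<^sup>2 / (1 - (cmod l)\<^sup>2)) / (1 - cmod l)\<^sup>2
    + (1 + cmod l) / (1 - cmod l) * sq_sum x"
  shows "summable (\<lambda>k. real (k + 1) * (cmod (a k))\<^sup>2)"
    and "(\<Sum>k. real (k + 1) * (cmod (a k))\<^sup>2) \<le> C"
proof -
  have factor: "1 - (cmod l)\<^sup>2 = (1 - cmod l) * (1 + cmod l)"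
    by (simp add: power2_eq_square algebra_simps)
  have bound: "(\<Sum>k<K. real (k + 1) * (cmod (a k))\<^sup>2) \<le> C" for K
  proof -
    \<comment> \<open>The nonpositive boundary term at \<open>K\<close> is dropped. The factor of
      \<open>sq_sum x\<close> becomes \<open>(1 - (cmod l)\<^sup>2) / (1 - cmod l)\<^sup>2\<close>,
      which is the quotient in \<open>C\<close>.\<close>
    have "((\<Sum>k<K. (cmod (d k))\<^sup>2) - real K * (cmod (d K))\<^sup>2) / (1 - (cmod l)\<^sup>2)
        \<le> (((cmod (d 0))\<^sup>2 + (1 - (cmod l)\<^sup>2)\<^sup>2 * sq_sum x) / (1 - cmod l)\<^sup>2) / (1 - (cmod l)\<^sup>2)"
      using state_partial_bound[OF x, of K] defect_pos
      by (intro divide_right_mono) (auto intro: order.trans[rotated])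
    also have "\<dots> = ((cmod (d 0))\<^sup>2 / (1 - (cmod l)\<^sup>2)) / (1 - cmod l)\<^sup>2
        + (1 + cmod l) / (1 - cmod l) * sq_sum x"
    proof -
      have "1 - cmod l \<noteq> 0" "1 + cmod l \<noteq> 0"
        using norm_less_1 norm_ge_zero[of l] by linarith+
      then show ?thesis
        unfolding factor by (simp add: divide_simps power2_eq_square)
    qed
    finally have "((\<Sum>k<K. (cmod (d k))\<^sup>2) - real K * (cmod (d K))\<^sup>2) / (1 - (cmod l)\<^sup>2)
      \<le> ((cmod (d 0))\<^sup>2 / (1 - (cmod l)\<^sup>2)) / (1 - cmod l)\<^sup>2
        + (1 + cmod l) / (1 - cmod l) * sq_sum x" .
    moreover have "(\<Sum>k<K. real (k + 1) * (cmod (x k))\<^sup>2) \<le> (\<Sum>k. real (k + 1) * (cmod (x k))\<^sup>2)"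
      by (intro sum_le_suminf wx) auto
    ultimately show ?thesis
      unfolding weighted_energy_sum C_def by linarith
  qed
  then show "summable (\<lambda>k. real (k + 1) * (cmod (a k))\<^sup>2)"
    by (intro summableI_nonneg_bounded) auto
  then show "(\<Sum>k. real (k + 1) * (cmod (a k))\<^sup>2) \<le> C"
    using bound by (rule suminf_le_const)
qed

end

text \<open>The linear system of \<open>blaschke_step\<close> is solved backwards, from the output \<open>a\<close>, by
  \<open>state_seq\<close> and \<open>quot_seq\<close>, and forwards, from the input \<open>x\<close> and the initial state \<open>c\<close>, by
  \<open>forward_state\<close> and \<open>forward_seq\<close>. The backward equation \<open>d k = l * d (k + 1) + (1 - (cmod l)\<^sup>2) * a k\<close>
  gives the series in \<open>state_seq\<close>.\<close>

definition state_seq :: "complex \<Rightarrow> (nat \<Rightarrow> complex) \<Rightarrow> nat \<Rightarrow> complex" where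
  "state_seq l a k = of_real (1 - (cmod l)\<^sup>2) * (\<Sum>i. a (i + k) * l ^ i)"

definition quot_seq :: "complex \<Rightarrow> (nat \<Rightarrow> complex) \<Rightarrow> nat \<Rightarrow> complex" where
  "quot_seq l a k = cnj l * a k - state_seq l a (Suc k)"

primrec forward_state :: "complex \<Rightarrow> complex \<Rightarrow> (nat \<Rightarrow> complex) \<Rightarrow> nat \<Rightarrow> complex" where
  "forward_state l c x 0 = c"
| "forward_state l c x (Suc k) = cnj l * forward_state l c x k - of_real (1 - (cmod l)\<^sup>2) * x k"

definition forward_seq :: "complex \<Rightarrow> complex \<Rightarrow> (nat \<Rightarrow> complex) \<Rightarrow> nat \<Rightarrow> complex" where
  "forward_seq l c x k = forward_state l c x k + l * x k"

section \<open>Solvability of the system in both directions, and square summability of the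
  quotient\<close>

lemma blaschke_step_forward:
  "cmod l < 1 \<Longrightarrow> blaschke_step l (forward_seq l c x) (forward_state l c x) x"
  by unfold_locales (auto simp: forward_seq_def)

lemma state_seq_summable:
  assumes "sq_summable a" "cmod l < 1"
  shows "summable (\<lambda>i. a (i + k) * l ^ i)"
  using sq_summable_power_series(2)[OF sq_summable_shift[OF assms(1)] assms(2)] .

lemma state_seq_diff:
  assumes "sq_summable a" "sq_summable b" "cmod l < 1"
  shows "state_seq l (\<lambda>k. a k - c * b k) = (\<lambda>k. state_seq l a k - c * state_seq l b k)"
proof
  fix k
  have "(\<Sum>i. (a (i + k) - c * b (i + k)) * l ^ i)
      = (\<Sum>i. a (i + k) * l ^ i - c * (b (i + k) * l ^ i))"
    by (simp add: algebra_simps)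
  also have "\<dots> = (\<Sum>i. a (i + k) * l ^ i) - c * (\<Sum>i. b (i + k) * l ^ i)"
    using state_seq_summable[OF assms(1,3)] state_seq_summable[OF assms(2,3)]
    by (simp add: suminf_diff [symmetric] suminf_mult summable_mult)
  finally show "state_seq l (\<lambda>k. a k - c * b k) k = state_seq l a k - c * state_seq l b k"
    unfolding state_seq_def by (simp only: right_diff_distrib mult.left_commute)
qed

lemma quot_seq_diff:
  assumes "sq_summable a" "sq_summable b" "cmod l < 1"
  shows "quot_seq l (\<lambda>k. a k - c * b k) = (\<lambda>k. quot_seq l a k - c * quot_seq l b k)"
  by (rule ext) (simp add: quot_seq_def state_seq_diff[OF assms] algebra_simps)

lemma blaschke_step_quot:
  assumes "sq_summable a" "cmod l < 1"
  shows "blaschke_step l a (state_seq l a) (quot_seq l a)"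
proof
  let ?s = "of_real (1 - (cmod l)\<^sup>2) :: complex"
  have s: "?s = 1 - l * cnj l"
    using complex_norm_square[of l] by simp
  have d: "state_seq l a k = l * state_seq l a (Suc k) + ?s * a k" for k
  proof -
    have "(\<Sum>i. a (i + k) * l ^ i) = a k + (\<Sum>i. l * (a (i + Suc k) * l ^ i))"
      using suminf_split_head[OF state_seq_summable[OF assms, of k]] by (simp add: mult_ac)
    also have "(\<Sum>i. l * (a (i + Suc k) * l ^ i)) = l * (\<Sum>i. a (i + Suc k) * l ^ i)"
      by (intro suminf_mult state_seq_summable assms)
    finally show ?thesis
      by (simp add: state_seq_def algebra_simps)
  qed
  fix k
  show "a k = state_seq l a k + l * quot_seq l a k"
    unfolding quot_seq_def d[of k] s by (simp add: algebra_simps)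
  show "state_seq l a (Suc k) = cnj l * state_seq l a k - ?s * quot_seq l a k"
    unfolding quot_seq_def d[of k] s by (simp add: algebra_simps)
qed (fact assms)

text \<open>A crude bound whose point is that it is uniform in \<open>k\<close>: it controls the
  boundary term of \<open>energy_sum\<close> in \<open>sq_summable_quot\<close>.\<close>

lemma state_seq_bounded:
  assumes "sq_summable a" "cmod l < 1"
  shows "cmod (state_seq l a k) \<le> sq_sum a + 1 / (1 - (cmod l)\<^sup>2)"
proof -
  have l2: "(cmod l)\<^sup>2 < 1"
    using assms(2) by (simp add: power_less_one_iff)
  have shifted: "sq_summable (\<lambda>i. a (i + k))"
    by (rule sq_summable_shift) fact
  note abs_summable = sq_summable_power_series(1)[OF shifted assms(2)]
  have "cmod (state_seq l a k) \<le> 1 * cmod (\<Sum>i. a (i + k) * l ^ i)"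
    unfolding state_seq_def norm_mult
    by (rule mult_right_mono) (use l2 in \<open>simp_all only: norm_of_real, auto\<close>)
  also have "\<dots> \<le> (\<Sum>i. cmod (a (i + k) * l ^ i))"
    using summable_norm[OF abs_summable] by simp
  also have "\<dots> \<le> (\<Sum>i. (cmod (a (i + k)))\<^sup>2 + ((cmod l)\<^sup>2) ^ i)"
  proof (rule suminf_le)
    fix i
    have "2 * cmod (a (i + k)) * cmod l ^ i \<le> (cmod (a (i + k)))\<^sup>2 + (cmod l ^ i)\<^sup>2"
      by (rule sum_squares_bound)
    moreover have "0 \<le> cmod (a (i + k)) * cmod l ^ i"
      by simp
    moreover have "(cmod l ^ i)\<^sup>2 = ((cmod l)\<^sup>2) ^ i"
      by (simp add: power_mult [symmetric] mult.commute)
    ultimately have "cmod (a (i + k)) * cmod l ^ i \<le> (cmod (a (i + k)))\<^sup>2 + ((cmod l)\<^sup>2) ^ i"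
      by linarith
    then show "cmod (a (i + k) * l ^ i) \<le> (cmod (a (i + k)))\<^sup>2 + ((cmod l)\<^sup>2) ^ i"
      by (simp add: norm_mult norm_power)
  next
    show "summable (\<lambda>i. (cmod (a (i + k)))\<^sup>2 + ((cmod l)\<^sup>2) ^ i)"
      using shifted l2 unfolding sq_summable_def by (intro summable_add summable_geometric) auto
  qed (fact abs_summable)
  also have "\<dots> = (\<Sum>i. (cmod (a (i + k)))\<^sup>2) + (\<Sum>i. ((cmod l)\<^sup>2) ^ i)"
    using shifted l2 unfolding sq_summable_def
    by (intro suminf_add [symmetric] summable_geometric) auto
  also have "(\<Sum>i. ((cmod l)\<^sup>2) ^ i) = 1 / (1 - (cmod l)\<^sup>2)"
    using l2 by (intro suminf_geometric) auto
  also have "(\<Sum>i. (cmod (a (i + k)))\<^sup>2) \<le> sq_sum a"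
    using suminf_split_initial_segment[of "\<lambda>i. (cmod (a i))\<^sup>2" k] assms(1)
    unfolding sq_summable_def sq_sum_def by (simp add: sum_nonneg)
  finally show ?thesis
    by simp
qed

text \<open>The energy balance bounds the partial sums for the quotient by those for
  \<open>a\<close> plus a boundary term in the state. Only boundedness of the state is available
  here, since \<open>state_tendsto_0\<close> presupposes the claim.\<close>

lemma sq_summable_quot:
  assumes a: "sq_summable a" and l: "cmod l < 1"
  shows "sq_summable (quot_seq l a)"
  unfolding sq_summable_def
proof (rule summableI_nonneg_bounded)
  interpret blaschke_step l a "state_seq l a" "quot_seq l a"
    by (rule blaschke_step_quot) fact+
  fix K
  let ?M = "sq_sum a + 1 / (1 - (cmod l)\<^sup>2)"
  have "(\<Sum>k<K. (cmod (a k))\<^sup>2) \<le> sq_sum a"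
    using a unfolding sq_summable_def sq_sum_def by (intro sum_le_suminf) auto
  moreover have "((cmod (state_seq l a 0))\<^sup>2 - (cmod (state_seq l a K))\<^sup>2) / (1 - (cmod l)\<^sup>2)
      \<ge> (0 - ?M\<^sup>2) / (1 - (cmod l)\<^sup>2)"
    using defect_pos state_seq_bounded[OF a l, of K]
    by (intro divide_right_mono diff_mono power_mono) auto
  ultimately show "(\<Sum>k<K. (cmod (quot_seq l a k))\<^sup>2) \<le> sq_sum a - (0 - ?M\<^sup>2) / (1 - (cmod l)\<^sup>2)"
    using energy_sum[of K] by linarith
qed auto

subsection \<open>The upper bound\<close>

lemma one_minus_cnj_mult_nonzero:
  assumes "cmod l < 1" "cmod z < 1"
  shows "1 - cnj l * z \<noteq> 0"
proof -
  have "cmod (cnj l * z) < 1"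
    using mult_strict_mono'[of "cmod l" 1 "cmod z" 1] assms by (simp add: norm_mult)
  then show ?thesis
    by auto
qed

text \<open>Peel off the first point, interpolate the quotient \<open>x\<close> by some
  \<open>y\<close> along the remaining points, and put the factor back; the empty list is
  interpolated by 0. The clause \<open>sq_sum g \<le> sq_sum a\<close> carries the induction,
  because the Dirichlet norm added by a point is controlled through \<open>sq_sum y\<close>.\<close>

lemma blaschke_interpolation:
  assumes r: "0 \<le> r" "r < 1" and "\<forall>l\<in>set \<sigma>. cmod l \<le> r" "sq_summable a"
  shows "\<exists>g h. sq_summable g \<and> sq_summable h \<and> sq_sum g \<le> sq_sum a \<and>
    summable (\<lambda>k. real (k + 1) * (cmod (g k))\<^sup>2) \<and>
    (\<Sum>k. real (k + 1) * (cmod (g k))\<^sup>2)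
      \<le> sq_sum a * (1 / (1 - r)\<^sup>2 + real (length \<sigma>) * ((1 + r) / (1 - r))) \<and>
    (\<forall>z. cmod z < 1 \<longrightarrow> power_series a z - power_series g z = blaschke_prod \<sigma> z * power_series h z)"
  using assms(3,4)
proof (induction \<sigma> arbitrary: a)
  case Nil
  have "power_series (\<lambda>_. 0) z = 0" for z
    by (simp add: eval_fps_def)
  then show ?case
    using Nil(2) sq_sum_nonneg[OF Nil(2)]
    by (intro exI[of _ "\<lambda>_. 0"] exI[of _ a]) (simp add: sq_summable_def[of "\<lambda>_. 0"]
      sq_sum_def[of "\<lambda>_. 0"] blaschke_prod_def)
next
  case (Cons l \<sigma>)
  let ?C = "(1 + r) / (1 - r)"
  have l: "cmod l \<le> r" "cmod l < 1"
    using Cons.prems r by auto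
  define x where "x = quot_seq l a"
  define c where "c = state_seq l a 0"
  interpret A: blaschke_step l a "state_seq l a" x
    unfolding x_def by (rule blaschke_step_quot) (use Cons.prems l in auto)
  have x: "sq_summable x"
    unfolding x_def by (rule sq_summable_quot) (use Cons.prems l in auto)
  obtain y h where y: "sq_summable y" and h: "sq_summable h" and yx: "sq_sum y \<le> sq_sum x"
    and wy: "summable (\<lambda>k. real (k + 1) * (cmod (y k))\<^sup>2)"
    and wy_le: "(\<Sum>k. real (k + 1) * (cmod (y k))\<^sup>2)
      \<le> sq_sum x * (1 / (1 - r)\<^sup>2 + real (length \<sigma>) * ?C)"
    and eq: "\<And>z. cmod z < 1 \<Longrightarrow>
      power_series x z - power_series y z = blaschke_prod \<sigma> z * power_series h z"
    using Cons.IH[OF _ x] Cons.prems by auto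
  interpret G: blaschke_step l "forward_seq l c y" "forward_state l c y" y
    by (rule blaschke_step_forward) fact
  \<comment> \<open>The same initial state \<open>c\<close> as for \<open>a\<close> makes the kernel
    terms cancel in the difference, leaving \<open>l - z\<close> times the difference for
    \<open>x\<close> and \<open>y\<close>.\<close>
  define g where "g = forward_seq l c y"
  define e where "e = (cmod c)\<^sup>2 / (1 - (cmod l)\<^sup>2)"
  have e: "e \<ge> 0"
    unfolding e_def using G.defect_pos by simp
  have a_sum: "sq_sum a = sq_sum x + e"
    using A.sq_sum_out[OF x] by (simp add: c_def e_def)
  have g_sum: "sq_sum g = sq_sum y + e"
    using G.sq_sum_out[OF y] by (simp add: g_def e_def)
  have C_mono: "(1 + cmod l) / (1 - cmod l) \<le> ?C"
    using l r by (intro frac_le) auto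
  have C: "?C \<ge> 0"
    using r by simp
  have "e / (1 - cmod l)\<^sup>2 \<le> e / (1 - r)\<^sup>2"
    using l r e by (intro divide_left_mono power_mono) auto
  moreover have "(1 + cmod l) / (1 - cmod l) * sq_sum y \<le> ?C * sq_sum x"
    by (intro mult_mono C_mono C yx sq_sum_nonneg y)
  ultimately have "(\<Sum>k. real (k + 1) * (cmod (g k))\<^sup>2)
      \<le> sq_sum x * (1 / (1 - r)\<^sup>2 + real (length \<sigma>) * ?C) + e / (1 - r)\<^sup>2 + ?C * sq_sum x"
    using G.weighted_sum_bound(2)[OF y wy] wy_le unfolding g_def e_def by simp
  \<comment> \<open>The energy \<open>e\<close> split off at \<open>l\<close> is charged only
    \<open>1 / (1 - r)\<^sup>2\<close>. Since \<open>sq_sum a = sq_sum x + e\<close>, these charges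
    add up to a term that does not grow with the length of the list.\<close>
  also have "\<dots> = sq_sum a * (1 / (1 - r)\<^sup>2) + sq_sum x * (real (length (l # \<sigma>)) * ?C)"
    unfolding a_sum by (simp add: algebra_simps add_divide_distrib)
  also have "\<dots> \<le> sq_sum a * (1 / (1 - r)\<^sup>2) + sq_sum a * (real (length (l # \<sigma>)) * ?C)"
    using a_sum e by (intro add_left_mono mult_right_mono mult_nonneg_nonneg C) auto
  finally have "(\<Sum>k. real (k + 1) * (cmod (g k))\<^sup>2)
      \<le> sq_sum a * (1 / (1 - r)\<^sup>2 + real (length (l # \<sigma>)) * ?C)"
    by (simp only: distrib_left)
  moreover have "power_series a z - power_series g z = blaschke_prod (l # \<sigma>) z * power_series h z"
    if z: "cmod z < 1" for z
  proof -
    have nz: "1 - cnj l * z \<noteq> 0"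
      by (rule one_minus_cnj_mult_nonzero) (use l z in auto)
    have "(1 - cnj l * z) * (power_series a z - power_series g z)
        = (l - z) * (power_series x z - power_series y z)"
      using A.power_series_out[OF x z] G.power_series_out[OF y z]
      by (simp add: g_def c_def algebra_simps)
    also have "\<dots> = (l - z) * (blaschke_prod \<sigma> z * power_series h z)"
      using eq[OF z] by simp
    finally show ?thesis
      using nz by (simp add: blaschke_prod_def blaschke_factor_def field_simps)
  qed
  moreover have "sq_summable g"
    unfolding g_def by (rule G.sq_summable_out[OF y])
  moreover have "summable (\<lambda>k. real (k + 1) * (cmod (g k))\<^sup>2)"
    unfolding g_def by (rule G.weighted_sum_bound(1)[OF y wy])
  moreover have "sq_sum g \<le> sq_sum a"
    using a_sum g_sum yx by simp
  ultimately show ?case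
    using h by blast
qed

lemma interp_const_H2_Dir_le:
  assumes r: "0 \<le> r" "r < 1" and \<sigma>: "\<forall>l\<in>set \<sigma>. cmod l \<le> r"
  shows "interp_const \<sigma> in_H2 H2_norm in_Dir Dir_norm
    \<le> ereal (sqrt (1 / (1 - r)\<^sup>2 + real (length \<sigma>) * ((1 + r) / (1 - r))))"
  unfolding interp_const_def
proof (rule SUP_least)
  let ?C = "1 / (1 - r)\<^sup>2 + real (length \<sigma>) * ((1 + r) / (1 - r))"
  fix f assume "f \<in> {f. in_H2 f \<and> H2_norm f \<le> 1}"
  then have f: "f holomorphic_on ball 0 1" and a: "sq_summable (taylor_coef f)"
    and norm: "sq_sum (taylor_coef f) \<le> 1"
    by (auto simp: in_H2_def sq_summable_def H2_norm_def sq_sum_def)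
  obtain g h where g: "sq_summable g" and h: "sq_summable h"
    and wg: "summable (\<lambda>k. real (k + 1) * (cmod (g k))\<^sup>2)"
    and bound: "(\<Sum>k. real (k + 1) * (cmod (g k))\<^sup>2) \<le> sq_sum (taylor_coef f) * ?C"
    and eq: "\<And>z. cmod z < 1 \<Longrightarrow>
      power_series (taylor_coef f) z - power_series g z = blaschke_prod \<sigma> z * power_series h z"
    using blaschke_interpolation[OF r \<sigma> a] by blast
  have "in_Dir (power_series g)"
    using g wg by (simp add: in_Dir_def holomorphic_power_series_unit_disc taylor_coef_power_series)
  moreover have "agree_on_seq \<sigma> (power_series g) f"
    unfolding agree_on_seq_def
    using holomorphic_power_series_unit_disc[OF h] eq power_series_taylor_coef[OF f] by force
  ultimately have "(INF g\<in>{g. in_Dir g \<and> agree_on_seq \<sigma> g f}. ereal (Dir_norm g))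
      \<le> ereal (Dir_norm (power_series g))"
    by (intro INF_lower) auto
  also have "\<dots> = ereal (sqrt (\<Sum>k. real (k + 1) * (cmod (g k))\<^sup>2))"
    by (simp add: Dir_norm_def taylor_coef_power_series[OF g])
  also have "\<dots> \<le> ereal (sqrt ?C)"
    using bound mult_right_mono[OF norm, of ?C] r by simp
  finally show "(INF g\<in>{g. in_Dir g \<and> agree_on_seq \<sigma> g f}. ereal (Dir_norm g)) \<le> ereal (sqrt ?C)" .
qed

lemma I_H2_Dir_le:
  assumes "0 \<le> r" "r < 1"
  shows "I_H2_Dir n r \<le> ereal (sqrt (1 / (1 - r)\<^sup>2 + real n * ((1 + r) / (1 - r))))"
  unfolding interp_nr_def
proof (rule SUP_least)
  fix \<sigma> assume \<sigma>: "\<sigma> \<in> {\<sigma>. length \<sigma> \<le> n \<and> (\<forall>l\<in>set \<sigma>. cmod l \<le> r)}"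
  have "real (length \<sigma>) * ((1 + r) / (1 - r)) \<le> real n * ((1 + r) / (1 - r))"
    using \<sigma> assms by (intro mult_right_mono) auto
  then have "ereal (sqrt (1 / (1 - r)\<^sup>2 + real (length \<sigma>) * ((1 + r) / (1 - r))))
      \<le> ereal (sqrt (1 / (1 - r)\<^sup>2 + real n * ((1 + r) / (1 - r))))"
    by simp
  with interp_const_H2_Dir_le[of r \<sigma>] assms \<sigma>
  show "interp_const \<sigma> in_H2 H2_norm in_Dir Dir_norm
      \<le> ereal (sqrt (1 / (1 - r)\<^sup>2 + real n * ((1 + r) / (1 - r))))"
    using order.trans by blast
qed

subsection \<open>The lower bound\<close>

lemma sq_summable_quot_iterate:
  assumes "sq_summable a" "cmod l < 1"
  shows "sq_summable ((quot_seq l ^^ j) a)"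
  using assms by (induction j) (auto intro: sq_summable_quot)

lemma quot_iterate_diff:
  assumes "sq_summable a" "sq_summable b" "cmod l < 1"
  shows "(quot_seq l ^^ j) (\<lambda>k. a k - c * b k)
    = (\<lambda>k. (quot_seq l ^^ j) a k - c * (quot_seq l ^^ j) b k)"
proof (induction j)
  case (Suc j)
  then show ?case
    using quot_seq_diff[OF sq_summable_quot_iterate[OF assms(1,3)]
        sq_summable_quot_iterate[OF assms(2,3)] assms(3)] by simp
qed simp

text \<open>A system started at time \<open>m\<close> is again a system, so
  \<open>sq_sum_out\<close> splits the tail energy into the state at \<open>m\<close> and the tail
  energy of the quotient; iterate and drop the last quotient. For \<open>m = 0\<close> this is
  Bessel's inequality for the Malmquist basis at the repeated point \<open>l\<close>.\<close>

lemma state_iterates_le_tail: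
  assumes "sq_summable a" "cmod l < 1"
  shows "(\<Sum>j<n. (cmod (state_seq l ((quot_seq l ^^ j) a) m))\<^sup>2 / (1 - (cmod l)\<^sup>2))
    \<le> sq_sum (\<lambda>k. a (k + m))"
  using assms(1)
proof (induction n arbitrary: a)
  case 0
  then show ?case
    by (simp add: sq_sum_nonneg sq_summable_shift)
next
  case (Suc n)
  interpret blaschke_step l a "state_seq l a" "quot_seq l a"
    by (rule blaschke_step_quot) fact+
  interpret tail: blaschke_step l "\<lambda>k. a (k + m)" "\<lambda>k. state_seq l a (k + m)"
      "\<lambda>k. quot_seq l a (k + m)"
    by (rule shift)
  have x: "sq_summable (quot_seq l a)"
    by (rule sq_summable_quot) fact+
  have "(\<Sum>j<Suc n. (cmod (state_seq l ((quot_seq l ^^ j) a) m))\<^sup>2 / (1 - (cmod l)\<^sup>2))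
      = (cmod (state_seq l a m))\<^sup>2 / (1 - (cmod l)\<^sup>2) +
        (\<Sum>j<n. (cmod (state_seq l ((quot_seq l ^^ j) (quot_seq l a)) m))\<^sup>2 / (1 - (cmod l)\<^sup>2))"
    by (simp add: sum.lessThan_Suc_shift funpow_swap1 del: sum.lessThan_Suc)
  also have "\<dots> \<le> (cmod (state_seq l a m))\<^sup>2 / (1 - (cmod l)\<^sup>2) + sq_sum (\<lambda>k. quot_seq l a (k + m))"
    by (intro add_left_mono Suc.IH x)
  also have "\<dots> = sq_sum (\<lambda>k. a (k + m))"
    using tail.sq_sum_out[OF sq_summable_shift[OF x]] by simp
  finally show ?case .
qed

text \<open>The entry \<open>a k\<close> belongs to the tails starting at 0, ..., \<open>k\<close>,
  hence is counted at most \<open>k + 1\<close> times. In the induction, passing to the shifted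
  sequence lowers each weight by one.\<close>

lemma tail_sums_le:
  assumes "summable (\<lambda>k. real (k + 1) * (cmod (a k))\<^sup>2)"
  shows "(\<Sum>m<M. sq_sum (\<lambda>k. a (k + m))) \<le> (\<Sum>k. real (k + 1) * (cmod (a k))\<^sup>2)"
  using assms
proof (induction M arbitrary: a)
  case 0
  then show ?case
    by (simp add: suminf_nonneg)
next
  case (Suc M)
  have a: "summable (\<lambda>k. (cmod (a k))\<^sup>2)"
    by (rule summable_comparison_test'[OF Suc.prems]) (simp add: algebra_simps)
  have ka: "summable (\<lambda>k. real k * (cmod (a k))\<^sup>2)"
    using summable_diff[OF Suc.prems a] by (simp add: algebra_simps)
  have shift: "summable (\<lambda>k. real (k + 1) * (cmod (a (k + 1)))\<^sup>2)"
    using summable_ignore_initial_segment[OF ka, of 1] by simp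
  have "(\<Sum>m<Suc M. sq_sum (\<lambda>k. a (k + m)))
      = sq_sum a + (\<Sum>m<M. sq_sum (\<lambda>k. a (k + m + 1)))"
    by (simp add: sum.lessThan_Suc_shift del: sum.lessThan_Suc)
  also have "\<dots> \<le> sq_sum a + (\<Sum>k. real (k + 1) * (cmod (a (k + 1)))\<^sup>2)"
    by (intro add_left_mono Suc.IH[of "\<lambda>k. a (k + 1)"] shift)
  also have "(\<Sum>k. real (k + 1) * (cmod (a (k + 1)))\<^sup>2) = (\<Sum>k. real k * (cmod (a k))\<^sup>2)"
    using suminf_split_head[OF ka] by simp
  also have "sq_sum a + (\<Sum>k. real k * (cmod (a k))\<^sup>2) = (\<Sum>k. real (k + 1) * (cmod (a k))\<^sup>2)"
    unfolding sq_sum_def by (subst suminf_add[OF a ka]) (simp add: algebra_simps)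
  finally show ?case .
qed

text \<open>Exchange the sums: at a fixed time \<open>m\<close> the states of all quotients are
  bounded by one tail of \<open>a\<close>, and the tails add up to the weighted sum. Times are cut
  off at \<open>M\<close>, which then tends to infinity.\<close>

lemma sum_sq_sum_state_le:
  assumes wa: "summable (\<lambda>k. real (k + 1) * (cmod (a k))\<^sup>2)" and a: "sq_summable a"
    and l: "cmod l < 1"
  shows "(\<Sum>j<n. sq_sum (state_seq l ((quot_seq l ^^ j) a)))
    \<le> (1 - (cmod l)\<^sup>2) * (\<Sum>k. real (k + 1) * (cmod (a k))\<^sup>2)"
proof (rule LIMSEQ_le_const2)
  let ?d = "\<lambda>j. state_seq l ((quot_seq l ^^ j) a)"
  have s: "0 < 1 - (cmod l)\<^sup>2"
    using l by (simp add: power_less_one_iff)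
  have "sq_summable (?d j)" for j
    using blaschke_step.sq_summable_state[OF blaschke_step_quot[OF _ l] sq_summable_quot[OF _ l]]
      sq_summable_quot_iterate[OF a l] by blast
  then show "(\<lambda>M. \<Sum>j<n. \<Sum>m<M. (cmod (?d j m))\<^sup>2) \<longlonglongrightarrow> (\<Sum>j<n. sq_sum (?d j))"
    unfolding sq_summable_def sq_sum_def by (intro tendsto_sum summable_LIMSEQ)
  have "(\<Sum>j<n. \<Sum>m<M. (cmod (?d j m))\<^sup>2)
      \<le> (1 - (cmod l)\<^sup>2) * (\<Sum>k. real (k + 1) * (cmod (a k))\<^sup>2)" for M
  proof -
    have "(\<Sum>j<n. \<Sum>m<M. (cmod (?d j m))\<^sup>2)
        = (1 - (cmod l)\<^sup>2) * (\<Sum>m<M. \<Sum>j<n. (cmod (?d j m))\<^sup>2 / (1 - (cmod l)\<^sup>2))"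
      using s by (subst sum.swap) (simp add: sum_distrib_left)
    also have "\<dots> \<le> (1 - (cmod l)\<^sup>2) * (\<Sum>m<M. sq_sum (\<lambda>k. a (k + m)))"
      using s by (intro mult_left_mono sum_mono state_iterates_le_tail a l) auto
    also have "\<dots> \<le> (1 - (cmod l)\<^sup>2) * (\<Sum>k. real (k + 1) * (cmod (a k))\<^sup>2)"
      using s by (intro mult_left_mono tail_sums_le wa) auto
    finally show ?thesis .
  qed
  then show "\<exists>N. \<forall>M\<ge>N. (\<Sum>j<n. \<Sum>m<M. (cmod (?d j m))\<^sup>2)
      \<le> (1 - (cmod l)\<^sup>2) * (\<Sum>k. real (k + 1) * (cmod (a k))\<^sup>2)"
    by blast
qed

text \<open>The state is \<open>a - l * quot_seq l a\<close>, so its own iterated states at \<open>0\<close> are the differences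
  \<open>c m - l * c (Suc m)\<close>; this is where alternating signs in \<open>c\<close> produce the factor \<open>1 + r\<close>.\<close>

lemma sq_sum_state_ge:
  assumes a: "sq_summable a" and l: "cmod l < 1"
  defines "c \<equiv> \<lambda>i. state_seq l ((quot_seq l ^^ i) a) 0"
  shows "(\<Sum>m<M. (cmod (c m - l * c (Suc m)))\<^sup>2) \<le> (1 - (cmod l)\<^sup>2) * sq_sum (state_seq l a)"
proof -
  have s: "0 < 1 - (cmod l)\<^sup>2"
    using l by (simp add: power_less_one_iff)
  have x: "sq_summable (quot_seq l a)"
    by (rule sq_summable_quot) fact+
  interpret blaschke_step l a "state_seq l a" "quot_seq l a"
    by (rule blaschke_step_quot) fact+
  have d: "state_seq l a = (\<lambda>k. a k - l * quot_seq l a k)"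
    using out_eq by (auto simp: fun_eq_iff algebra_simps)
  have "state_seq l ((quot_seq l ^^ m) (state_seq l a)) 0 = c m - l * c (Suc m)" for m
    unfolding d quot_iterate_diff[OF a x l] c_def
    by (subst state_seq_diff) (auto simp: funpow_swap1 intro!: sq_summable_quot_iterate a x l)
  then have "(\<Sum>m<M. (cmod (c m - l * c (Suc m)))\<^sup>2 / (1 - (cmod l)\<^sup>2)) \<le> sq_sum (state_seq l a)"
    using state_iterates_le_tail[OF sq_summable_state[OF x] l, of 0 M] by simp
  then show ?thesis
    using s by (simp add: sum_divide_distrib [symmetric] field_simps)
qed

text \<open>Combines the two preceding estimates, the second applied to each iterated quotient. The
  free cutoffs \<open>M j\<close> allow restricting to those \<open>c i\<close> that interpolation
  determines.\<close>

lemma weighted_sum_ge: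
  assumes wa: "summable (\<lambda>k. real (k + 1) * (cmod (a k))\<^sup>2)" and a: "sq_summable a"
    and l: "cmod l < 1"
  defines "c \<equiv> \<lambda>i. state_seq l ((quot_seq l ^^ i) a) 0"
  shows "(\<Sum>j<n. \<Sum>m<M j. (cmod (c (m + j) - l * c (Suc (m + j))))\<^sup>2)
    \<le> (1 - (cmod l)\<^sup>2)\<^sup>2 * (\<Sum>k. real (k + 1) * (cmod (a k))\<^sup>2)"
proof -
  have s: "0 < 1 - (cmod l)\<^sup>2"
    using l by (simp add: power_less_one_iff)
  have "(\<Sum>m<M j. (cmod (c (m + j) - l * c (Suc (m + j))))\<^sup>2)
      \<le> (1 - (cmod l)\<^sup>2) * sq_sum (state_seq l ((quot_seq l ^^ j) a))" for j
    using sq_sum_state_ge[OF sq_summable_quot_iterate[OF a l] l, of j "M j"]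
    by (simp add: c_def funpow_add)
  then have "(\<Sum>j<n. \<Sum>m<M j. (cmod (c (m + j) - l * c (Suc (m + j))))\<^sup>2)
      \<le> (\<Sum>j<n. (1 - (cmod l)\<^sup>2) * sq_sum (state_seq l ((quot_seq l ^^ j) a)))"
    by (rule sum_mono)
  also have "\<dots> \<le> (1 - (cmod l)\<^sup>2) * ((1 - (cmod l)\<^sup>2) * (\<Sum>k. real (k + 1) * (cmod (a k))\<^sup>2))"
    unfolding sum_distrib_left [symmetric] using s
    by (intro mult_left_mono sum_sq_sum_state_le wa a l) auto
  finally show ?thesis
    by (simp add: power2_eq_square mult.assoc)
qed

section \<open>The test function and the coefficients shared by its interpolants\<close>

text \<open>For \<open>cmod l < 1\<close> these are the Taylor coefficients of the sum of
  \<open>cs ! i\<close> times the Szego kernel at \<open>l\<close> times the \<open>i\<close>-th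
  power of \<open>blaschke_factor l\<close>: a combination of Malmquist basis functions before
  normalization.\<close>

primrec test_seq :: "complex \<Rightarrow> complex list \<Rightarrow> nat \<Rightarrow> complex" where
  "test_seq l [] = (\<lambda>_. 0)"
| "test_seq l (c # cs) = forward_seq l c (test_seq l cs)"

lemma test_seq:
  assumes "cmod l < 1"
  shows "sq_summable (test_seq l cs)"
    and "sq_sum (test_seq l cs) = (\<Sum>c\<leftarrow>cs. (cmod c)\<^sup>2 / (1 - (cmod l)\<^sup>2))"
proof (induction cs)
  case Nil
  {
    case 1
    show ?case by (simp add: sq_summable_def)
  next
    case 2
    show ?case by (simp add: sq_sum_def)
  }
next
  case (Cons c cs)
  interpret blaschke_step l "forward_seq l c (test_seq l cs)" "forward_state l c (test_seq l cs)"
      "test_seq l cs"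
    by (rule blaschke_step_forward) fact
  {
    case 1
    show ?case
      using sq_summable_out[OF Cons.IH(1)] by simp
  next
    case 2
    show ?case
      using sq_sum_out[OF Cons.IH(1)] Cons.IH(2) by simp
  }
qed

lemma blaschke_prod_holomorphic:
  assumes "\<forall>l\<in>set \<sigma>. cmod l < 1"
  shows "blaschke_prod \<sigma> holomorphic_on ball 0 1"
  using assms
proof (induction \<sigma>)
  case (Cons l \<sigma>)
  have "(\<lambda>z. (l - z) / (1 - cnj l * z) * blaschke_prod \<sigma> z) holomorphic_on ball 0 1"
    using Cons by (intro holomorphic_intros) (auto dest: one_minus_cnj_mult_nonzero)
  then show ?case
    by (simp add: blaschke_prod_def blaschke_factor_def)
qed (simp add: blaschke_prod_def [abs_def])

text \<open>Evaluation at \<open>l\<close> identifies the first coefficient; cancelling the common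
  factor \<open>l - z\<close> then leaves the same situation for the quotient of \<open>b\<close>
  and one point fewer. This makes the lower bound valid for every interpolant at once.\<close>

lemma agreeing_state_eq:
  assumes l: "cmod l < 1" and "sq_summable b" and h: "h holomorphic_on ball 0 1"
    and "\<And>z. cmod z < 1 \<Longrightarrow> power_series (test_seq l cs) z - power_series b z
      = blaschke_prod (replicate (length cs) l) z * h z"
    and "i < length cs"
  shows "state_seq l ((quot_seq l ^^ i) b) 0 = cs ! i"
  using assms(2,4,5)
proof (induction cs arbitrary: b i)
  case (Cons c cs)
  define x where "x = quot_seq l b"
  have x: "sq_summable x"
    unfolding x_def by (rule sq_summable_quot) fact+
  have f: "sq_summable (test_seq l cs)"
    by (rule test_seq) fact
  interpret B: blaschke_step l b "state_seq l b" x
    unfolding x_def by (rule blaschke_step_quot) fact+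
  interpret F: blaschke_step l "forward_seq l c (test_seq l cs)" "forward_state l c (test_seq l cs)"
      "test_seq l cs"
    by (rule blaschke_step_forward) fact
  let ?H = "\<lambda>z. blaschke_prod (replicate (length cs) l) z * h z"
  let ?D = "\<lambda>z. power_series (test_seq l cs) z - power_series x z - ?H z"
  have eq: "(c - state_seq l b 0) + (l - z) * ?D z = 0" if z: "cmod z < 1" for z
  proof -
    have nz: "1 - cnj l * z \<noteq> 0"
      by (rule one_minus_cnj_mult_nonzero) fact+
    have "(1 - cnj l * z) * (power_series (test_seq l (c # cs)) z - power_series b z)
        = (l - z) * ?H z"
      using Cons.prems(2)[OF z] nz by (simp add: blaschke_prod_def blaschke_factor_def)
    also have "(1 - cnj l * z) * (power_series (test_seq l (c # cs)) z - power_series b z)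
        = c + (l - z) * power_series (test_seq l cs) z
          - (state_seq l b 0 + (l - z) * power_series x z)"
      unfolding right_diff_distrib B.power_series_out[OF x z] test_seq.simps F.power_series_out[OF f z]
      by simp
    finally show ?thesis
      by (simp add: algebra_simps)
  qed
  have c: "state_seq l b 0 = c"
    using eq[OF l] by simp
  have D0: "?D z = 0" if "cmod z < 1" "z \<noteq> l" for z
    using eq[OF that(1)] that(2) by (simp add: c)
  \<comment> \<open>The factor \<open>l - z\<close> can be cancelled only away from
    \<open>l\<close>; continuity supplies the value at \<open>l\<close>.\<close>
  have "?D holomorphic_on ball 0 1"
    using l by (intro holomorphic_intros holomorphic_power_series_unit_disc f x h
      blaschke_prod_holomorphic) auto
  then have "isCont ?D l"
    using l by (intro continuous_on_interior[OF holomorphic_on_imp_continuous_on]) auto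
  then have "(?D \<longlongrightarrow> ?D l) (at l)"
    by (rule isContD)
  moreover have "eventually (\<lambda>z. 0 = ?D z) (at l)"
  proof -
    have "eventually (\<lambda>z. z \<in> ball 0 1 - {l}) (at l)"
      using l by (intro eventually_at_in_open) auto
    then show ?thesis
      by eventually_elim (use D0 in auto)
  qed
  then have "(?D \<longlongrightarrow> 0) (at l)"
    by (rule Lim_transform_eventually[OF tendsto_const])
  ultimately have "?D l = 0"
    by (rule LIM_unique)
  with D0 have "power_series (test_seq l cs) z - power_series x z = ?H z" if "cmod z < 1" for z
    using that by (cases "z = l") auto
  with Cons.IH[OF x] have "state_seq l ((quot_seq l ^^ j) x) 0 = cs ! j" if "j < length cs" for j
    using that by blast
  with Cons.prems(3) c show ?case
    by (cases i) (auto simp: x_def funpow_swap1)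
qed simp

lemma sum_reversed_gauss: "(\<Sum>j<n. real (n - Suc j)) = real n * (real n - 1) / 2"
proof -
  have "(\<Sum>j<n. real (n - Suc j)) = (\<Sum>j<n. real j)"
    by (rule sum.nat_diff_reindex)
  also have "\<dots> = real n * (real n - 1) / 2"
    by (induction n) (auto simp: field_simps)
  finally show ?thesis .
qed

lemma I_H2_Dir_ge:
  assumes n: "n \<ge> 1" and r: "0 \<le> r" "r < 1"
  shows "ereal (sqrt ((1 + r) / 2 * (1 - 1 / real n)) * sqrt (real n / (1 - r))) \<le> I_H2_Dir n r"
proof -
  define l where "l = complex_of_real r"
  define s where "s = 1 - r\<^sup>2"
  have norm_l: "cmod l = r"
    using r by (simp add: l_def)
  have l: "cmod l < 1"
    using norm_l r by simp
  have s: "s > 0"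
    using r by (simp add: s_def power_less_one_iff)
  have s_factor: "s = (1 - r) * (1 + r)"
    by (simp add: s_def power2_eq_square algebra_simps)
  \<comment> \<open>Each \<open>c i\<close> contributes \<open>1 / n\<close> to the squared norm,
    giving norm 1 in total; the alternating sign turns \<open>c i - l * c (Suc i)\<close> into
    \<open>(1 + r) * c i\<close>.\<close>
  define c where "c i = complex_of_real ((-1) ^ i * sqrt (s / real n))" for i
  define cs where "cs = map c [0..<n]"
  have norm_c: "(cmod (c i))\<^sup>2 = s / real n" for i
  proof -
    have "cmod (c i) = sqrt (s / real n)"
      unfolding c_def norm_of_real using s by (simp add: abs_mult power_abs)
    then show ?thesis
      using s by simp
  qed
  have diff_c: "(cmod (c i - l * c (Suc i)))\<^sup>2 = s * (1 + r)\<^sup>2 / real n" for i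
  proof -
    have "c i - l * c (Suc i) = of_real (1 + r) * c i"
      by (simp add: c_def l_def algebra_simps)
    then show ?thesis
      using norm_c[of i] by (simp add: norm_mult power_mult_distrib del: of_real_add)
  qed
  let ?f = "power_series (test_seq l cs)"
  let ?lower = "sqrt ((1 + r) / 2 * (1 - 1 / real n)) * sqrt (real n / (1 - r))"
  note f = test_seq[OF l, of cs]
  have "(\<Sum>c\<leftarrow>cs. (cmod c)\<^sup>2 / (1 - (cmod l)\<^sup>2)) = 1"
    using s n by (simp add: cs_def norm_c norm_l sum_list_triv comp_def flip: s_def)
  with f(2) have "sq_sum (test_seq l cs) = 1"
    by simp
  then have f_ball: "?f \<in> {f. in_H2 f \<and> H2_norm f \<le> 1}"
    using f(1) by (simp add: in_H2_def H2_norm_def holomorphic_power_series_unit_disc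
      taylor_coef_power_series sq_summable_def [symmetric] sq_sum_def [symmetric])
  have "ereal ?lower \<le> ereal (Dir_norm g)" 
    if g: "in_Dir g" and agree: "agree_on_seq (replicate n l) g ?f" for g
  proof -
    define b where "b = taylor_coef g"
    have hol: "g holomorphic_on ball 0 1" and wb: "summable (\<lambda>k. real (k + 1) * (cmod (b k))\<^sup>2)"
      using g by (auto simp: in_Dir_def b_def)
    have b: "sq_summable b"
      unfolding sq_summable_def by (rule summable_comparison_test'[OF wb]) (simp add: algebra_simps)
    obtain h where h: "h holomorphic_on ball 0 1"
      and eq: "\<And>z. cmod z < 1 \<Longrightarrow> ?f z - g z = blaschke_prod (replicate n l) z * h z"
      using agree by (auto simp: agree_on_seq_def)
    have "state_seq l ((quot_seq l ^^ i) b) 0 = cs ! i" if "i < n" for i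
      using that eq power_series_taylor_coef[OF hol]
      by (intro agreeing_state_eq[OF l b h]) (auto simp: b_def cs_def)
    then have state: "state_seq l ((quot_seq l ^^ i) b) 0 = c i" if "i < n" for i
      using that by (simp add: cs_def)
    let ?Q = "\<Sum>k. real (k + 1) * (cmod (b k))\<^sup>2"
    let ?C = "\<lambda>i. state_seq l ((quot_seq l ^^ i) b) 0"
    \<comment> \<open>The cutoff \<open>n - Suc j\<close> keeps \<open>Suc (m + j)\<close> below
      \<open>n\<close>, where the coefficients are known. The number of remaining pairs,
      \<open>n * (n - 1) / 2\<close>, is the origin of the factor \<open>1 - 1 / n\<close>.\<close>
    have "(\<Sum>j<n. \<Sum>m<n - Suc j. (cmod (?C (m + j) - l * ?C (Suc (m + j))))\<^sup>2)
        = (\<Sum>j<n. \<Sum>m<n - Suc j. s * (1 + r)\<^sup>2 / real n)"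
      using state diff_c by (intro sum.cong refl) (simp del: funpow.simps)
    also have "\<dots> = s * (1 + r)\<^sup>2 / real n * (\<Sum>j<n. real (n - Suc j))"
      by (simp only: sum_constant card_lessThan sum_distrib_right mult.commute)
    also have "\<dots> = s * (1 + r)\<^sup>2 * (real n - 1) / 2"
      unfolding sum_reversed_gauss using n by simp
    finally have "s * (1 + r)\<^sup>2 * (real n - 1) / 2 \<le> s\<^sup>2 * ?Q"
      using weighted_sum_ge[OF wb b l, where n = n and M = "\<lambda>j. n - Suc j"] by (simp add: norm_l s_def)
    then have "s * ((1 + r)\<^sup>2 * (real n - 1) / 2) \<le> s * (s * ?Q)"
      by (simp add: power2_eq_square mult.assoc)
    then have "(1 + r)\<^sup>2 * (real n - 1) / 2 \<le> s * ?Q"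
      using s mult_le_cancel_left_pos by blast
    then have "(1 + r) * ((1 + r) * (real n - 1) / 2) \<le> (1 + r) * ((1 - r) * ?Q)"
      by (simp add: s_factor power2_eq_square mult_ac)
    then have "(1 + r) * (real n - 1) / 2 \<le> (1 - r) * ?Q"
      using r mult_le_cancel_left_pos[of "1 + r"] by simp
    then have "(1 + r) * (real n - 1) / 2 / (1 - r) \<le> ?Q"
      using r by (subst pos_divide_le_eq) (simp_all only: mult.commute diff_gt_0_iff_gt)
    also have "(1 + r) * (real n - 1) / 2 / (1 - r)
        = (1 + r) / 2 * (1 - 1 / real n) * (real n / (1 - r))"
      using n by (simp add: right_diff_distrib left_diff_distrib diff_divide_distrib)
    finally have "(1 + r) / 2 * (1 - 1 / real n) * (real n / (1 - r)) \<le> ?Q" .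
    then show ?thesis
      by (simp add: Dir_norm_def b_def real_sqrt_mult [symmetric])
  qed
  then have "ereal ?lower \<le> (INF g\<in>{g. in_Dir g \<and> agree_on_seq (replicate n l) g ?f}.
      ereal (Dir_norm g))"
    by (intro INF_greatest) auto
  also have "\<dots> \<le> interp_const (replicate n l) in_H2 H2_norm in_Dir Dir_norm"
    unfolding interp_const_def by (rule SUP_upper[OF f_ball])
  also have "\<dots> \<le> I_H2_Dir n r"
    unfolding interp_nr_def by (rule SUP_upper) (use norm_l in auto)
  finally show ?thesis .
qed

subsection \<open>Asymptotics\<close>

text \<open>The factor \<open>K\<close> serves two normalizations: \<open>K = 1\<close> for fixed
  \<open>r\<close>, and \<open>K = sqrt (1 - r)\<close> before letting \<open>r\<close> tend to
  1.\<close>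

lemma liminf_I_H2_Dir_ge:
  assumes r: "0 \<le> r" "r < 1" and K: "0 \<le> K"
  shows "ereal (K * sqrt (((1 + r) / 2) / (1 - r)))
    \<le> liminf (\<lambda>n. ereal (K / sqrt (real n)) * I_H2_Dir n r)"
proof -
  let ?L = "\<lambda>n. K * sqrt ((1 + r) / 2 * (1 - 1 / real n) / (1 - r))"
  have "(\<lambda>n. ereal (?L n)) \<longlonglongrightarrow> ereal (K * sqrt ((1 + r) / 2 * (1 - 0) / (1 - r)))"
    using r by (intro tendsto_intros lim_1_over_n) auto
  then have "liminf (\<lambda>n. ereal (?L n)) = ereal (K * sqrt ((1 + r) / 2 * (1 - 0) / (1 - r)))"
    by (rule lim_imp_Liminf[rotated]) simp
  then have "ereal (K * sqrt ((1 + r) / 2 / (1 - r))) = liminf (\<lambda>n. ereal (?L n))"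
    by simp
  also have "\<dots> \<le> liminf (\<lambda>n. ereal (K / sqrt (real n)) * I_H2_Dir n r)"
  proof (rule Liminf_mono)
    show "\<forall>\<^sub>F n in sequentially. ereal (?L n) \<le> ereal (K / sqrt (real n)) * I_H2_Dir n r"
      using eventually_ge_at_top[of "1::nat"]
    proof eventually_elim
      case (elim n)
      have "?L n = K / sqrt (real n) * (sqrt ((1 + r) / 2 * (1 - 1 / real n)) * sqrt (real n / (1 - r)))"
        by (simp only: real_sqrt_divide) (use elim in simp)
      then have "ereal (?L n) = ereal (K / sqrt (real n))
          * ereal (sqrt ((1 + r) / 2 * (1 - 1 / real n)) * sqrt (real n / (1 - r)))"
        by (simp only: times_ereal.simps)
      also have "\<dots> \<le> ereal (K / sqrt (real n)) * I_H2_Dir n r"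
        using K by (intro ereal_mult_left_mono I_H2_Dir_ge elim r) auto
      finally show ?case .
    qed
  qed
  finally show ?thesis .
qed

lemma limsup_I_H2_Dir_le:
  assumes r: "0 \<le> r" "r < 1" and K: "0 \<le> K"
  shows "limsup (\<lambda>n. ereal (K / sqrt (real n)) * I_H2_Dir n r)
    \<le> ereal (K * sqrt ((1 + r) / (1 - r)))"
proof -
  \<comment> \<open>After division by \<open>n\<close>, the length-independent error
    \<open>1 / (1 - r)\<^sup>2\<close> of the upper bound disappears in the limit.\<close>
  let ?U = "\<lambda>n. K * sqrt (1 / (1 - r)\<^sup>2 * (1 / real n) + (1 + r) / (1 - r))"
  have "(\<lambda>n. ereal (?U n)) \<longlonglongrightarrow> ereal (K * sqrt (1 / (1 - r)\<^sup>2 * 0 + (1 + r) / (1 - r)))"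
    by (intro tendsto_intros lim_1_over_n)
  then have U: "limsup (\<lambda>n. ereal (?U n)) = ereal (K * sqrt ((1 + r) / (1 - r)))"
    by (simp add: lim_imp_Limsup)
  have "limsup (\<lambda>n. ereal (K / sqrt (real n)) * I_H2_Dir n r) \<le> limsup (\<lambda>n. ereal (?U n))"
  proof (rule Limsup_mono)
    show "\<forall>\<^sub>F n in sequentially. ereal (K / sqrt (real n)) * I_H2_Dir n r \<le> ereal (?U n)"
      using eventually_ge_at_top[of "1::nat"]
    proof eventually_elim
      case (elim n)
      let ?B = "1 / (1 - r)\<^sup>2 + real n * ((1 + r) / (1 - r))"
      have "ereal (K / sqrt (real n)) * I_H2_Dir n r \<le> ereal (K / sqrt (real n)) * ereal (sqrt ?B)"
        using K by (intro ereal_mult_left_mono I_H2_Dir_le r) auto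
      also have "\<dots> = ereal (K * sqrt (?B / real n))"
        by (simp add: real_sqrt_divide)
      also have "?B / real n = 1 / (1 - r)\<^sup>2 * (1 / real n) + (1 + r) / (1 - r)"
        using elim by (simp add: add_divide_distrib)
      finally show ?case .
    qed
  qed
  then show ?thesis
    unfolding U .
qed

theorem theoremB:
  shows "(\<forall>(n::nat) (r::real). n \<ge> 1 \<and> 0 \<le> r \<and> r < 1 \<longrightarrow>
            ereal (sqrt ((1 + r) / 2 * (1 - 1 / real n)) * sqrt (real n / (1 - r)))
              \<le> I_H2_Dir n r)
       \<and> (\<forall>r::real. 0 \<le> r \<and> r < 1 \<longrightarrow>
            ereal (sqrt (((1 + r) / 2) / (1 - r)))
              \<le> liminf (\<lambda>n. ereal (1 / sqrt (real n)) * I_H2_Dir n r)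
          \<and> liminf (\<lambda>n. ereal (1 / sqrt (real n)) * I_H2_Dir n r)
              \<le> limsup (\<lambda>n. ereal (1 / sqrt (real n)) * I_H2_Dir n r)
          \<and> limsup (\<lambda>n. ereal (1 / sqrt (real n)) * I_H2_Dir n r)
              \<le> ereal (sqrt ((1 + r) / (1 - r))))
       \<and> (ereal (sqrt 2 / 2)
            \<le> Liminf (at_left 1) (\<lambda>r::real. liminf (\<lambda>n. ereal (sqrt ((1 - r) / real n)) * I_H2_Dir n r))
          \<and> Liminf (at_left 1) (\<lambda>r::real. liminf (\<lambda>n. ereal (sqrt ((1 - r) / real n)) * I_H2_Dir n r))
            \<le> Limsup (at_left 1) (\<lambda>r::real. limsup (\<lambda>n. ereal (sqrt ((1 - r) / real n)) * I_H2_Dir n r))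
          \<and> Limsup (at_left 1) (\<lambda>r::real. limsup (\<lambda>n. ereal (sqrt ((1 - r) / real n)) * I_H2_Dir n r))
            \<le> ereal (sqrt 2))"
proof (intro conjI allI impI; (elim conjE)?)
  fix n :: nat and r :: real
  assume "1 \<le> n" "0 \<le> r" "r < 1"
  then show "ereal (sqrt ((1 + r) / 2 * (1 - 1 / real n)) * sqrt (real n / (1 - r))) \<le> I_H2_Dir n r"
    by (rule I_H2_Dir_ge)
next
  fix r :: real
  assume r: "0 \<le> r" "r < 1"
  show "ereal (sqrt (((1 + r) / 2) / (1 - r)))
      \<le> liminf (\<lambda>n. ereal (1 / sqrt (real n)) * I_H2_Dir n r)"
    using liminf_I_H2_Dir_ge[OF r, of 1] by simp
  show "liminf (\<lambda>n. ereal (1 / sqrt (real n)) * I_H2_Dir n r)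
      \<le> limsup (\<lambda>n. ereal (1 / sqrt (real n)) * I_H2_Dir n r)"
    by (rule Liminf_le_Limsup) simp
  show "limsup (\<lambda>n. ereal (1 / sqrt (real n)) * I_H2_Dir n r) \<le> ereal (sqrt ((1 + r) / (1 - r)))"
    using limsup_I_H2_Dir_le[OF r, of 1] by simp
next
  let ?I = "\<lambda>r n. ereal (sqrt ((1 - r) / real n)) * I_H2_Dir n r"
  \<comment> \<open>Both outer bounds are proved for each \<open>r\<close> in the open unit interval
    separately, from \<open>1 \<le> 1 + r\<close> and \<open>1 + r \<le> 2\<close>.\<close>
  have near_1: "\<forall>\<^sub>F r in at_left (1::real). r \<in> {0<..<1}"
    by (rule eventually_at_leftI[of 0]) auto
  show "ereal (sqrt 2 / 2) \<le> Liminf (at_left 1) (\<lambda>r. liminf (?I r))"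
  proof (rule Liminf_bounded)
    show "\<forall>\<^sub>F r in at_left 1. ereal (sqrt 2 / 2) \<le> liminf (?I r)"
      using near_1
    proof eventually_elim
      case (elim r)
      have "sqrt 2 / 2 = sqrt (1 / 2)"
        by (simp add: real_sqrt_divide field_simps)
      also have "\<dots> \<le> sqrt ((1 + r) / 2)"
        using elim by simp
      also have "\<dots> = sqrt ((1 - r) * ((1 + r) / 2 / (1 - r)))"
        using elim by (metis greaterThanLessThan_iff less_irrefl nonzero_mult_div_cancel_left
          right_minus_eq times_divide_eq_right)
      also have "\<dots> = sqrt (1 - r) * sqrt ((1 + r) / 2 / (1 - r))"
        by (rule real_sqrt_mult)
      finally show ?case
        using liminf_I_H2_Dir_ge[of r "sqrt (1 - r)"] elim
        by (auto simp: real_sqrt_divide intro: order.trans[rotated])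
    qed
  qed
  show "Liminf (at_left 1) (\<lambda>r. liminf (?I r)) \<le> Limsup (at_left 1) (\<lambda>r. limsup (?I r))"
  proof -
    have "Liminf (at_left 1) (\<lambda>r. liminf (?I r)) \<le> Liminf (at_left 1) (\<lambda>r. limsup (?I r))"
      by (intro Liminf_mono always_eventually allI Liminf_le_Limsup) simp
    also have "\<dots> \<le> Limsup (at_left 1) (\<lambda>r. limsup (?I r))"
      by (rule Liminf_le_Limsup) simp
    finally show ?thesis .
  qed
  show "Limsup (at_left 1) (\<lambda>r. limsup (?I r)) \<le> ereal (sqrt 2)"
  proof (rule Limsup_bounded)
    show "\<forall>\<^sub>F r in at_left 1. limsup (?I r) \<le> ereal (sqrt 2)"
      using near_1
    proof eventually_elim
      case (elim r)
      have "sqrt (1 - r) * sqrt ((1 + r) / (1 - r)) = sqrt ((1 - r) * ((1 + r) / (1 - r)))"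
        by (rule real_sqrt_mult [symmetric])
      also have "\<dots> \<le> sqrt 2"
        using elim by simp
      finally show ?case
        using limsup_I_H2_Dir_le[of r "sqrt (1 - r)"] elim
        by (auto simp: real_sqrt_divide intro: order.trans)
    qed
  qed
qed

end
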